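(* Let $\Omega\subset\mathbb{R}^2$ be a compact convex set with non-empty interior whose minimal unfolded region $uf(\Omega)$ is contained in the interior of $\Omega$. If $$0<h\le\sqrt{2}\,\min\{|z-w|: z\in uf(\Omega),\ w\in\partial\Omega\},$$ then $\Omega$ has a unique solid angle center of height $h$.
   Context: $A_\Omega^{(h)}(x)=\int_\Omega \frac{h}{(|y-x|^2+h^2)^{3/2}}\,dy$; a solid angle center of height $h$ is a maximizer of $A_\Omega^{(h)}$ over $\mathbb{R}^2$. Minimal unfolded region: for $v\in S^1$ and $c\in\mathbb{R}$ let $I_{v,c}$ be the reflection in the line $\{z: z\cdot v=c\}$, $\Omega^+_{v,a}=\Omega\cap\{z\cdot v\ge a\}$, $\Omega^-_{v,a}=\Omega\cap\{z\cdot v\le a\}$, $u(v)=\inf\{b: I_{v,c}(\Omega^+_{v,c})\subset\Omega\ \forall c\ge b\}$, $l(v)=\sup\{b: I_{v,c}(\Omega^-_{v,c})\subset\Omega\ \forall c\le b\}$, and $uf(\Omega)=\bigcap_{v\in S^1}\{z\in\mathbb{R}^2: l(v)\le z\cdot v\le u(v)\}$. *)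

theory Defs
  imports "HOL-Analysis.Analysis"
begin

definition solid_angle :: "(real^2) set \<Rightarrow> real \<Rightarrow> real^2 \<Rightarrow> real" where
  "solid_angle \<Omega> h x = integral \<Omega> (\<lambda>y. h / ((norm (y - x))\<^sup>2 + h\<^sup>2) powr (3/2))"

definition solid_angle_center :: "(real^2) set \<Rightarrow> real \<Rightarrow> real^2 \<Rightarrow> bool" where
  "solid_angle_center \<Omega> h x \<longleftrightarrow> (\<forall>y. solid_angle \<Omega> h y \<le> solid_angle \<Omega> h x)"

text \<open>Reflection in the line {z. z \<bullet> v = c} (v a unit vector).\<close>
definition refl_line :: "real^2 \<Rightarrow> real \<Rightarrow> real^2 \<Rightarrow> real^2" where
  "refl_line v c z = z - (2 * (z \<bullet> v - c)) *\<^sub>R v"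

definition cap_plus :: "(real^2) set \<Rightarrow> real^2 \<Rightarrow> real \<Rightarrow> (real^2) set" where
  "cap_plus \<Omega> v a = \<Omega> \<inter> {z. z \<bullet> v \<ge> a}"

definition cap_minus :: "(real^2) set \<Rightarrow> real^2 \<Rightarrow> real \<Rightarrow> (real^2) set" where
  "cap_minus \<Omega> v a = \<Omega> \<inter> {z. z \<bullet> v \<le> a}"

definition uf_upper :: "(real^2) set \<Rightarrow> real^2 \<Rightarrow> real" where
  "uf_upper \<Omega> v = Inf {b. \<forall>c\<ge>b. refl_line v c ` cap_plus \<Omega> v c \<subseteq> \<Omega>}"

definition uf_lower :: "(real^2) set \<Rightarrow> real^2 \<Rightarrow> real" where
  "uf_lower \<Omega> v = Sup {b. \<forall>c\<le>b. refl_line v c ` cap_minus \<Omega> v c \<subseteq> \<Omega>}"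

definition min_unfolded :: "(real^2) set \<Rightarrow> (real^2) set" where
  "min_unfolded \<Omega> = (\<Inter>v\<in>sphere 0 1.
     {z. uf_lower \<Omega> v \<le> z \<bullet> v \<and> z \<bullet> v \<le> uf_upper \<Omega> v})"

end

theory Submission
  imports Defs
begin

text \<open>A maximizer lies in the minimal unfolded region: if \<open>x \<bullet> v > u(v)\<close>, reflecting \<open>x\<close> in a line
\<open>z \<bullet> v = c\<close> with \<open>u(v) < c < x \<bullet> v\<close> strictly increases the solid angle. For uniqueness, polar
coordinates around \<open>x\<close> give \<open>A(x) = \<integral> g(\<rho>\<^sub>x(\<theta>)) d\<theta>\<close>, where \<open>\<rho>\<^sub>x(\<theta>)\<close> is the distance from \<open>x\<close> to the
boundary of \<open>\<Omega>\<close> in direction \<open>\<theta>\<close> and \<open>g(\<rho>) = 1 - h / sqrt (\<rho>\<^sup>2 + h\<^sup>2)\<close>. By convexity of \<open>\<Omega>\<close> the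
function \<open>\<rho>\<^sub>x(\<theta>)\<close> is concave in \<open>x\<close>, and \<open>g\<close> is increasing, and strictly concave for \<open>\<rho> \<ge> h / sqrt 2\<close>;
the bound on \<open>h\<close> says exactly that all the radii seen from \<open>uf(\<Omega>)\<close> are in this range. Hence the
midpoint of two distinct maximizers would have a larger solid angle than both.\<close>

subsection \<open>Integration\<close>

text \<open>A nonnegative integrable function with integral zero vanishes almost everywhere, whereas
  a nonempty open set is never null. Both strict inequalities between solid angles are obtained
  through this criterion.\<close>

lemma integral_pos_open:
  fixes f :: "'a::euclidean_space \<Rightarrow> real"
  assumes f: "integrable lborel f" and nonneg: "\<And>x. 0 \<le> f x"
    and U: "open U" "U \<noteq> {}" and pos: "\<And>x. x \<in> U \<Longrightarrow> 0 < f x"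
  shows "0 < integral\<^sup>L lborel f"
proof -
  have "integral\<^sup>L lborel f \<noteq> 0"
  proof
    assume "integral\<^sup>L lborel f = 0"
    then have "AE x in lborel. f x = 0"
      using integral_nonneg_eq_0_iff_AE[OF f] nonneg by auto
    then have "AE x in lborel. x \<notin> U"
      by eventually_elim (use pos in force)
    moreover have "U \<in> sets borel" using U by simp
    ultimately have "U \<in> null_sets lborel"
      by (subst AE_iff_null_sets) auto
    then have "negligible U"
      using negligible_iff_null_sets null_sets_completionI by blast
    with U open_not_negligible show False by blast
  qed
  moreover have "0 \<le> integral\<^sup>L lborel f" using nonneg by (simp add: integral_nonneg_AE)
  ultimately show ?thesis by simp
qed

text \<open>The vector-valued change of variables theorem is applied to \<open>f\<close> regarded as
  a map into \<open>real ^ 1\<close>.\<close>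

lemma has_absolute_integral_change_of_variables_scalar:
  fixes f :: "real^'m::{finite,wellorder} \<Rightarrow> real" and g :: "real^'m::_ \<Rightarrow> real^'m::_"
  assumes S: "S \<in> sets lebesgue"
    and der_g: "\<And>x. x \<in> S \<Longrightarrow> (g has_derivative g' x) (at x within S)"
    and inj: "inj_on g S"
  shows "(\<lambda>x. \<bar>det (matrix (g' x))\<bar> * f (g x)) absolutely_integrable_on S \<and>
           integral S (\<lambda>x. \<bar>det (matrix (g' x))\<bar> * f (g x)) = b
     \<longleftrightarrow> f absolutely_integrable_on (g ` S) \<and> integral (g ` S) f = b"
proof -
  have "(\<lambda>x. \<bar>det (matrix (g' x))\<bar> *\<^sub>R vec (f(g x)) :: real ^ 1) absolutely_integrable_on S \<and>
           integral S (\<lambda>x. \<bar>det (matrix (g' x))\<bar> *\<^sub>R vec (f(g x))) = (vec b :: real ^ 1)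
         \<longleftrightarrow> (\<lambda>x. vec (f x) :: real ^ 1) absolutely_integrable_on (g ` S) \<and>
           integral (g ` S) (\<lambda>x. vec (f x)) = (vec b :: real ^ 1)"
    by (intro has_absolute_integral_change_of_variables assms) auto
  thus ?thesis
    by (simp add: absolutely_integrable_on_1_iff integral_on_1_eq)
qed

text \<open>Change of variables in a form suited to Lebesgue integrals over the whole space. The
  image of \<open>g\<close> only has to be conull, so that polar coordinates, which miss the origin,
  are covered as well as reflections; \<open>D\<close> is a Borel function that agrees with the
  absolute Jacobian on \<open>S\<close>.\<close>

lemma borel_change_of_variables:
  fixes f :: "real^'m::{finite,wellorder} \<Rightarrow> real" and g :: "real^'m::_ \<Rightarrow> real^'m::_"
  assumes S[measurable]: "S \<in> sets borel"
    and der_g: "\<And>x. x \<in> S \<Longrightarrow> (g has_derivative g' x) (at x within S)"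
    and inj: "inj_on g S" and gS: "negligible (- (g ` S))"
    and g[measurable]: "g \<in> borel_measurable borel"
    and det: "\<And>x. x \<in> S \<Longrightarrow> \<bar>det (matrix (g' x))\<bar> = D x"
    and D[measurable]: "D \<in> borel_measurable borel"
    and f: "integrable lborel f"
  shows "integrable lborel (\<lambda>x. indicator S x * (D x * f (g x)))" (is "integrable _ ?F")
    and "(\<integral>x. indicator S x * (D x * f (g x)) \<partial>lborel) = integral\<^sup>L lborel f"
proof -
  have [measurable]: "f \<in> borel_measurable borel" using f by auto
  have f1: "f absolutely_integrable_on UNIV" "integral UNIV f = integral\<^sup>L lborel f"
    using f set_borel_integral_eq_integral[of UNIV f]
    by (auto simp: set_integrable_def integrable_completion set_lebesgue_integral_def)
  \<comment> \<open>Replacing the whole space by the image of \<open>g\<close> changes the domain by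
    a null set only, so neither integrability nor the integral is affected.\<close>
  have "negligible ((UNIV - g ` S) \<union> (g ` S - UNIV))" using gS by (simp add: Compl_eq_Diff_UNIV)
  moreover have "negligible {x \<in> UNIV - g ` S. f x \<noteq> 0}" "negligible {x \<in> g ` S - UNIV. f x \<noteq> 0}"
    by (auto intro: negligible_subset[OF gS])
  moreover from calculation have "f absolutely_integrable_on g ` S"
    by (intro absolutely_integrable_spike_set[OF f1(1)])
      (auto intro: negligible_subset)
  ultimately have "f absolutely_integrable_on g ` S" "integral (g ` S) f = integral\<^sup>L lborel f"
    using f1(2) integral_spike_set[where f = f and S = UNIV and T = "g ` S"] by auto
  then have c: "(\<lambda>x. \<bar>det (matrix (g' x))\<bar> * f (g x)) absolutely_integrable_on S \<and>
      integral S (\<lambda>x. \<bar>det (matrix (g' x))\<bar> * f (g x)) = integral\<^sup>L lborel f"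
    using has_absolute_integral_change_of_variables_scalar[OF _ der_g inj, of f "integral\<^sup>L lborel f"] S
    by (simp add: sets_completionI_sets)
  have "(\<lambda>x. D x * f (g x)) absolutely_integrable_on S"
    using c set_integrable_cong[of lebesgue lebesgue S S "\<lambda>x. \<bar>det (matrix (g' x))\<bar> * f (g x)" "\<lambda>x. D x * f (g x)"] det
    by auto
  then have *: "integrable lborel ?F"
    by (simp add: set_integrable_def integrable_completion)
  have "integral S (\<lambda>x. D x * f (g x)) = integral\<^sup>L lborel f"
    using c Henstock_Kurzweil_Integration.integral_cong[of S "\<lambda>x. \<bar>det (matrix (g' x))\<bar> * f (g x)" "\<lambda>x. D x * f (g x)"] det
    by simp
  moreover have "integral\<^sup>L lborel ?F = integral S (\<lambda>x. D x * f (g x))"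
    using set_borel_integral_eq_integral(2)[of S "\<lambda>x. D x * f (g x)"] *
    by (simp add: set_integrable_def set_lebesgue_integral_def)
  ultimately show "integrable lborel ?F" "integral\<^sup>L lborel ?F = integral\<^sup>L lborel f"
    using * by auto
qed

section \<open>The plane as a product, and polar coordinates\<close>

lemma borel_measurable_vector2 [measurable]:
  "(\<lambda>(a,b). vector [a, b] :: real^2) \<in> borel_measurable borel" (is "?v \<in> _")
proof -
  have v: "?v = (\<lambda>p. \<chi> i. if i = 1 then fst p else snd p)"
    by (auto simp: vec_eq_iff forall_2 fun_eq_iff)
  have "continuous_on UNIV (\<lambda>p::real\<times>real. if i = (1::2) then fst p else snd p)" for i
    by (cases "i = 1") (auto intro!: continuous_intros)
  then show ?thesis
    unfolding v by (intro borel_measurable_continuous_onI continuous_on_vec_lambda)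
qed

text \<open>Boxes pull back to boxes of the same area, and boxes determine Lebesgue measure. This
  lets Fubini's theorem for pairs of reals be used on \<open>real^2\<close>.\<close>

lemma lborel_vec2:
  "distr lborel borel (\<lambda>(a,b). vector [a, b]) = (lborel :: (real^2) measure)"
    (is "distr lborel borel ?v = _")
proof (rule lborel_eqI[symmetric])
  show "sets (distr lborel borel ?v) = sets borel" by simp
  fix l u :: "real^2" assume le: "\<And>b. b \<in> Basis \<Longrightarrow> l \<bullet> b \<le> u \<bullet> b"
  have B: "(Basis :: (real^2) set) = {axis 1 1, axis 2 1}"
    by (auto simp: Basis_vec_def UNIV_2)
  have ne: "axis 1 1 \<noteq> (axis 2 1 :: real^2)" by (simp add: axis_eq_axis)
  have "?v -` box l u = box (l$1) (u$1) \<times> box (l$2) (u$2)"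
    by (auto simp: mem_box_cart forall_2)
  also have "\<dots> = box (l$1, l$2) (u$1, u$2)" by (auto simp: box_def Basis_prod_def)
  finally have "emeasure (distr lborel borel ?v) (box l u) = emeasure lborel (box (l$1, l$2) (u$1, u$2))"
    by (subst emeasure_distr) auto
  also have "\<dots> = ennreal ((u$1 - l$1) * (u$2 - l$2))"
    using le[of "axis 1 1"] le[of "axis 2 1"] by (subst emeasure_lborel_box_eq)
      (auto simp: Basis_prod_def B inner_axis inner_Pair)
  also have "\<dots> = (\<Prod>b\<in>Basis. (u - l) \<bullet> b)"
    unfolding B using ne by (simp add: inner_axis)
  finally show "emeasure (distr lborel borel ?v) (box l u) = (\<Prod>b\<in>Basis. (u - l) \<bullet> b)" .
qed

definition polar :: "real \<Rightarrow> real \<Rightarrow> real^2" where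
  "polar r t = vector [r * cos t, r * sin t]"

lemma polar_scaleR: "polar r t = r *\<^sub>R polar 1 t"
  by (simp add: polar_def vec_eq_iff forall_2)

lemma norm_polar [simp]: "norm (polar r t) = \<bar>r\<bar>"
proof -
  have "(r * cos t)\<^sup>2 + (r * sin t)\<^sup>2 = r\<^sup>2 * ((cos t)\<^sup>2 + (sin t)\<^sup>2)"
    by (simp add: algebra_simps power_mult_distrib del: sin_cos_squared_add sin_cos_squared_add2)
  then show ?thesis
    by (simp add: polar_def norm_vec_def L2_set_def sum_2)
qed

lemma continuous_polar:
  fixes S :: "'a::t2_space set"
  assumes "continuous_on S f" "continuous_on S g"
  shows "continuous_on S (\<lambda>p. polar (f p) (g p))"
proof -
  have "continuous_on S (\<lambda>p. if i = (1::2) then f p * cos (g p) else f p * sin (g p))" for i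
    using assms by (cases "i = 1") (auto intro!: continuous_intros)
  moreover have "polar (f p) (g p) = (\<chi> i. if i = 1 then f p * cos (g p) else f p * sin (g p))" for p
    by (simp add: polar_def vec_eq_iff forall_2)
  ultimately show ?thesis by (auto intro!: continuous_on_vec_lambda)
qed

lemma polar_exists:
  assumes "y \<noteq> 0"
  obtains t where "-pi < t" "t \<le> pi" "y = polar (norm y) t"
proof -
  let ?z = "Complex (y$1) (y$2)"
  have n: "cmod ?z = norm y" by (simp add: norm_vec_def L2_set_def sum_2 cmod_def)
  have "y = polar (norm y) (Arg ?z)"
    using rcis_cmod_Arg[of ?z] unfolding n
    by (simp add: polar_def vec_eq_iff forall_2 complex_eq_iff)
  then show ?thesis using that[of "Arg ?z"] mpi_less_Arg Arg_le_pi by blast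
qed

lemma polar_inj:
  assumes "0 < r" "0 < r'" "-pi < t" "t \<le> pi" "-pi < t'" "t' \<le> pi" "polar r t = polar r' t'"
  shows "r = r'" "t = t'"
proof -
  show "r = r'" using assms norm_polar by (metis abs_of_pos)
  with assms have "cos t = cos t'" "sin t = sin t'"
    by (auto simp: polar_def vec_eq_iff forall_2)
  then have "cis t = cis t'" by (simp add: complex_eq_iff)
  then show "t = t'" using assms
    by (metis cis_Arg_unique norm_cis sgn_cis)
qed

text \<open>Polar coordinates are injective on the strip of positive radii and angles in (-pi, pi],
  with Jacobian \<open>r\<close>. Change of variables on this strip is followed by Fubini, with the
  radius as the inner variable.\<close>

lemma
  fixes f :: "real^2 \<Rightarrow> real"
  assumes f: "integrable lborel f"
  shows integrable_polar:
      "integrable lborel (\<lambda>t. indicator {-pi<..pi} t * (\<integral>r. indicator {0<..} r * (r * f (polar r t)) \<partial>lborel))"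
    and integral_polar:
      "integral\<^sup>L lborel f =
        (\<integral>t. indicator {-pi<..pi} t * (\<integral>r. indicator {0<..} r * (r * f (polar r t)) \<partial>lborel) \<partial>lborel)"
proof -
  define S where "S = {p::real^2. 0 < p$1 \<and> -pi < p$2 \<and> p$2 \<le> pi}"
  define g where "g p = polar (p$1) (p$2)" for p :: "real^2"
  define g' where "g' p q = (vector [q$1 * cos (p$2) - p$1 * sin (p$2) * q$2,
      q$1 * sin (p$2) + p$1 * cos (p$2) * q$2] :: real^2)" for p q :: "real^2"
  define F where "F p = indicator S p * (\<bar>p$1\<bar> * f (g p))" for p
  have [measurable]: "f \<in> borel_measurable borel" using f by auto
  have [measurable]: "(\<lambda>p::real^2. p$i) \<in> borel_measurable borel" for i
    by (intro borel_measurable_continuous_onI continuous_intros)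
  have [measurable]: "S \<in> sets borel" unfolding S_def by measurable
  have [measurable]: "g \<in> borel_measurable borel"
    unfolding g_def by (intro borel_measurable_continuous_onI continuous_polar continuous_intros)
  have der: "(g has_derivative g' p) (at p within S)" if "p \<in> S" for p
  proof -
    have nth: "((\<lambda>p::real^2. p $ i) has_derivative (\<lambda>q. q $ i)) (at p within S)" for i
      by (rule bounded_linear_imp_has_derivative[OF bounded_linear_vec_nth])
    have "((\<lambda>p. g p $ i) has_derivative (\<lambda>q. g' p q $ i)) (at p within S)" for i
    proof -
      have "i = 1 \<or> i = 2" using exhaust_2 by auto
      then show ?thesis
        by (auto simp: g_def g'_def polar_def algebra_simps
            intro!: derivative_eq_intros nth)
    qed
    then show ?thesis
      by (subst has_derivative_componentwise_within)
        (auto simp: Basis_vec_def inner_axis)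
  qed
  have inj: "inj_on g S"
  proof (rule inj_onI)
    fix p q assume "p \<in> S" "q \<in> S" "g p = g q"
    then have "p$1 = q$1" "p$2 = q$2"
      using polar_inj[of "p$1" "q$1" "p$2" "q$2"] by (simp_all add: S_def g_def)
    then show "p = q" by (simp add: vec_eq_iff forall_2)
  qed
  \<comment> \<open>Every nonzero point has polar coordinates in the strip, so only the origin can
    be missed.\<close>
  have "- (g ` S) \<subseteq> {0}"
  proof
    fix y assume "y \<in> - (g ` S)"
    show "y \<in> {0}"
    proof (rule ccontr)
      assume "y \<notin> {0}"
      then obtain t where "-pi < t" "t \<le> pi" "y = polar (norm y) t" by (auto elim: polar_exists)
      then have "vector [norm y, t] \<in> S" "y = g (vector [norm y, t])"
        using \<open>y \<notin> {0}\<close> by (auto simp: S_def g_def)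
      with \<open>y \<in> - (g ` S)\<close> show False by blast
    qed
  qed
  then have neg: "negligible (- (g ` S))" by (rule negligible_subset[rotated]) simp
  have det: "\<bar>det (matrix (g' p))\<bar> = \<bar>p$1\<bar>" for p
  proof -
    have "det (matrix (g' p)) = p$1 * ((cos (p$2))\<^sup>2 + (sin (p$2))\<^sup>2)"
      by (simp add: det_2 matrix_def g'_def axis_def power2_eq_square algebra_simps del: sin_cos_squared_add3)
    then show ?thesis by simp
  qed
  have F: "integrable lborel F" "integral\<^sup>L lborel F = integral\<^sup>L lborel f"
    using borel_change_of_variables[of S g g' "\<lambda>p. \<bar>p$1\<bar>" f] der inj neg det f
    unfolding F_def by simp_all
  \<comment> \<open>\<open>G\<close> carries the integrand from \<open>real^2\<close> over to pairs,
    where Fubini applies.\<close>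
  define G where "G p = F ((\<lambda>(a,b). vector [a, b]) p)" for p
  have [measurable]: "F \<in> borel_measurable borel" using F(1) by auto
  have meas: "(\<lambda>(a,b). vector [a, b] :: real^2) \<in> measurable lborel borel"
    by simp
  have G1: "integrable lborel G"
    unfolding G_def using integrable_distr_eq[OF meas, of F] F(1) unfolding lborel_vec2 by simp
  have G2: "integral\<^sup>L lborel G = integral\<^sup>L lborel f"
    unfolding G_def using integral_distr[OF meas, of F] F(2) unfolding lborel_vec2 by simp
  have G3: "integrable (lborel \<Otimes>\<^sub>M lborel) (case_prod (\<lambda>r t. G (r, t)))"
    unfolding lborel_prod case_prod_eta by (rule G1)
  have eq: "indicator {-pi<..pi} t * (\<integral>r. indicator {0<..} r * (r * f (polar r t)) \<partial>lborel) = (\<integral>r. G (r, t) \<partial>lborel)" for t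
    by (subst Bochner_Integration.integral_mult_right_zero[symmetric], intro Bochner_Integration.integral_cong)
      (auto simp: G_def F_def S_def g_def indicator_def)
  show "integrable lborel (\<lambda>t. indicator {-pi<..pi} t * (\<integral>r. indicator {0<..} r * (r * f (polar r t)) \<partial>lborel))"
    unfolding eq using lborel_pair.integrable_snd[OF G3] .
  show "integral\<^sup>L lborel f =
        (\<integral>t. indicator {-pi<..pi} t * (\<integral>r. indicator {0<..} r * (r * f (polar r t)) \<partial>lborel) \<partial>lborel)"
    unfolding eq using lborel_pair.integral_snd[OF G3] G2 unfolding lborel_prod case_prod_eta by simp
qed

subsection \<open>The solid angle kernel and reflections\<close>

definition solid_kernel :: "real \<Rightarrow> real^2 \<Rightarrow> real" where
  "solid_kernel h y = h / ((norm y)\<^sup>2 + h\<^sup>2) powr (3/2)"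

lemma continuous_solid_kernel: "0 < h \<Longrightarrow> continuous_on S (solid_kernel h)"
  unfolding solid_kernel_def by (intro continuous_intros) (auto simp: add_nonneg_eq_0_iff)

lemma borel_measurable_solid_kernel [measurable]: "solid_kernel h \<in> borel_measurable borel"
  unfolding solid_kernel_def by measurable

lemma solid_kernel_nonneg: "0 < h \<Longrightarrow> 0 \<le> solid_kernel h y"
  unfolding solid_kernel_def by simp

lemma solid_kernel_less:
  assumes "0 < h" "norm x < norm y" shows "solid_kernel h y < solid_kernel h x"
proof -
  have "(norm x)\<^sup>2 + h\<^sup>2 < (norm y)\<^sup>2 + h\<^sup>2" using assms by (simp add: power_strict_mono)
  then have "((norm x)\<^sup>2 + h\<^sup>2) powr (3/2) < ((norm y)\<^sup>2 + h\<^sup>2) powr (3/2)"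
    by (intro powr_less_mono2) auto
  then show ?thesis unfolding solid_kernel_def using assms
    by (intro divide_strict_left_mono) (auto simp: add_nonneg_eq_0_iff)
qed

lemma solid_kernel_mono: "0 < h \<Longrightarrow> norm x \<le> norm y \<Longrightarrow> solid_kernel h y \<le> solid_kernel h x"
  using solid_kernel_less[of h x y] by (cases "norm x = norm y") (auto simp: solid_kernel_def)

lemma integrable_solid_angle:
  assumes "compact \<Omega>" "0 < h"
  shows "integrable lborel (\<lambda>y. indicator \<Omega> y * solid_kernel h (y - x))"
proof -
  have "continuous_on \<Omega> (\<lambda>y. solid_kernel h (y - x))"
    by (rule continuous_on_compose2[OF continuous_solid_kernel[of h UNIV]])
      (auto intro!: continuous_intros assms)
  from borel_integrable_compact[OF assms(1) this] show ?thesis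
    by (rule back_subst[of "integrable lborel"]) (auto simp: indicator_def fun_eq_iff)
qed

lemma solid_angle_eq_lborel:
  assumes "compact \<Omega>" "0 < h"
  shows "solid_angle \<Omega> h x = (\<integral>y. indicator \<Omega> y * solid_kernel h (y - x) \<partial>lborel)"
  using set_borel_integral_eq_integral(2)[of \<Omega> "\<lambda>y. solid_kernel h (y - x)"]
    integrable_solid_angle[OF assms]
  by (simp add: solid_angle_def set_integrable_def set_lebesgue_integral_def solid_kernel_def)

text \<open>The linear part \<open>?L\<close> of the reflection preserves inner products, so the
  Jacobian has absolute value 1.\<close>

lemma
  fixes f :: "real^2 \<Rightarrow> real"
  assumes v: "norm v = 1" and f: "integrable lborel f"
  shows integrable_refl_line: "integrable lborel (\<lambda>y. f (refl_line v c y))"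
    and integral_refl_line: "(\<integral>y. f (refl_line v c y) \<partial>lborel) = integral\<^sup>L lborel f"
proof -
  have vv: "v \<bullet> v = 1" using v by (simp add: dot_square_norm)
  have inv: "refl_line v c (refl_line v c y) = y" for y
    by (simp add: refl_line_def inner_diff_left vv algebra_simps)
  let ?L = "\<lambda>y. y - (2 * (y \<bullet> v)) *\<^sub>R v"
  have "(?L y) \<bullet> (?L z) = y \<bullet> z" for y z
    using vv by (simp add: inner_diff_left inner_diff_right algebra_simps inner_commute)
  moreover have "linear ?L"
    by (intro linearI) (auto simp: inner_add_left algebra_simps)
  ultimately have "orthogonal_transformation ?L"
    by (simp add: orthogonal_transformation_def)
  then have det: "\<bar>det (matrix ?L)\<bar> = 1" by simp
  have der: "(refl_line v c has_derivative ?L) (at x within UNIV)" for x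
    unfolding refl_line_def by (auto intro!: derivative_eq_intros simp: algebra_simps)
  have inj: "inj_on (refl_line v c) UNIV" by (metis inv injI)
  have surj: "range (refl_line v c) = UNIV" by (metis inv surjI)
  have m: "refl_line v c \<in> borel_measurable borel"
    unfolding refl_line_def by measurable
  have "negligible (- range (refl_line v c))" by (simp add: surj)
  note * = borel_change_of_variables[where S=UNIV and g="refl_line v c" and g'="\<lambda>_. ?L" and D="\<lambda>_. 1", OF _ der inj this m det _ f]
  show "integrable lborel (\<lambda>y. f (refl_line v c y))"
    using *(1) by simp
  show "(\<integral>y. f (refl_line v c y) \<partial>lborel) = integral\<^sup>L lborel f"
    using *(2) by simp
qed

section \<open>Existence of a maximizer\<close>

lemma solid_angle_center_exists:
  assumes "compact \<Omega>" "\<Omega> \<noteq> {}" "0 < h"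
  shows "\<exists>x. solid_angle_center \<Omega> h x"
proof -
  note int = integrable_solid_angle[OF assms(1,3)]
  note eq = solid_angle_eq_lborel[OF assms(1,3)]
  obtain x0 where x0: "x0 \<in> \<Omega>" using assms by auto
  obtain D where D: "\<And>y. y \<in> \<Omega> \<Longrightarrow> dist x0 y \<le> D"
    using compact_imp_bounded[OF assms(1)] bounded_any_center[of \<Omega> x0] by auto
  \<comment> \<open>All of \<open>\<Omega>\<close> lies within \<open>D\<close> of
    \<open>x0\<close>. A point at distance at least \<open>2 * D\<close> from \<open>x0\<close> is
    therefore at least \<open>D\<close> away from every \<open>y\<close> in \<open>\<Omega>\<close>,
    hence no closer to \<open>y\<close> than \<open>x0\<close> is. The search for a maximum thus
    reduces to a closed ball.\<close>
  have far: "solid_angle \<Omega> h x \<le> solid_angle \<Omega> h x0" if "2 * D \<le> dist x0 x" for x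
    unfolding eq
  proof (rule integral_mono[OF int int])
    fix y
    have "norm (y - x0) \<le> norm (y - x)" if "y \<in> \<Omega>"
      using D[OF that] \<open>2 * D \<le> dist x0 x\<close> dist_triangle[of x0 x y]
      by (simp add: dist_norm norm_minus_commute)
    then show "indicator \<Omega> y * solid_kernel h (y - x) \<le> indicator \<Omega> y * solid_kernel h (y - x0)"
      using assms(3) by (auto simp: indicator_def intro: solid_kernel_mono)
  qed
  have "continuous_on UNIV (solid_angle \<Omega> h)"
  proof (rule continuous_on_sequentiallyI)
    fix X and x :: "real^2" assume X: "X \<longlonglongrightarrow> x"
    have [measurable]: "\<Omega> \<in> sets borel" using assms(1) by (simp add: borel_compact)
    show "(\<lambda>n. solid_angle \<Omega> h (X n)) \<longlonglongrightarrow> solid_angle \<Omega> h x"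
      unfolding eq
    \<comment> \<open>The kernel is largest at the origin, so its value there, restricted to
      \<open>\<Omega>\<close>, dominates all the integrands.\<close>
    proof (rule integral_dominated_convergence[where w="\<lambda>y. indicator \<Omega> y * solid_kernel h 0"])
      show "integrable lborel (\<lambda>y. indicator \<Omega> y * solid_kernel h 0)"
        using borel_integrable_compact[OF assms(1), of "\<lambda>_. solid_kernel h 0"]
        by (rule back_subst[of "integrable lborel"]) (auto simp: indicator_def fun_eq_iff)
      have "(\<lambda>n. solid_kernel h (y - X n)) \<longlonglongrightarrow> solid_kernel h (y - x)" for y
        using continuous_solid_kernel[OF assms(3), of UNIV] X
        by (intro continuous_on_tendsto_compose[where f="solid_kernel h" and s=UNIV] tendsto_intros) auto
      then show "AE y in lborel. (\<lambda>n. indicator \<Omega> y * solid_kernel h (y - X n)) \<longlonglongrightarrow> indicator \<Omega> y * solid_kernel h (y - x)"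
        by (intro AE_I2 tendsto_intros)
      show "AE y in lborel. norm (indicator \<Omega> y * solid_kernel h (y - X n)) \<le> indicator \<Omega> y * solid_kernel h 0" for n
        using solid_kernel_mono[OF assms(3), of 0] solid_kernel_nonneg[OF assms(3)]
        by (auto simp: indicator_def)
    qed simp_all
  qed
  then have "continuous_on (cball x0 (2 * D)) (solid_angle \<Omega> h)"
    by (rule continuous_on_subset) simp
  moreover have D0: "0 \<le> D" using D[OF x0] by simp
  ultimately obtain m where m: "m \<in> cball x0 (2*D)"
    "\<And>y. y \<in> cball x0 (2*D) \<Longrightarrow> solid_angle \<Omega> h y \<le> solid_angle \<Omega> h m"
    using continuous_attains_sup[OF compact_cball, of x0 "2*D" "solid_angle \<Omega> h"] by auto
  have "solid_angle \<Omega> h y \<le> solid_angle \<Omega> h m" for y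
    using m(2)[of y] m(2)[of x0] far[of y] D0 by (cases "2 * D \<le> dist x0 y") auto
  then show ?thesis unfolding solid_angle_center_def by blast
qed

section \<open>Folding along lines: maximizers lie in the minimal unfolded region\<close>

lemma norm_refl_line_diff:
  assumes "norm v = 1"
  shows "(norm (y - refl_line v c x))\<^sup>2 = (norm (y - x))\<^sup>2 + 4 * (y \<bullet> v - c) * (x \<bullet> v - c)"
proof -
  have "v \<bullet> v = 1" using assms by (simp add: dot_square_norm)
  then show ?thesis
    unfolding power2_norm_eq_inner refl_line_def
    by (simp add: inner_diff_left inner_diff_right inner_commute algebra_simps)
qed

lemma refl_line_inner: "norm v = 1 \<Longrightarrow> refl_line v c y \<bullet> v = 2 * c - y \<bullet> v"
  by (simp add: refl_line_def inner_diff_left dot_square_norm)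

lemma refl_line_involution: "norm v = 1 \<Longrightarrow> refl_line v c (refl_line v c y) = y"
  by (simp add: refl_line_def inner_diff_left dot_square_norm algebra_simps)

text \<open>The gain from reflecting \<open>x\<close> is an integral whose symmetrized integrand is
  a product of two factors of equal sign. Below the line, the folding condition makes the first
  factor nonnegative, and the second is nonnegative because the mirror image of \<open>x\<close> is
  nearer; above the line both signs turn around.\<close>

lemma solid_angle_refl_line_less:
  assumes \<Omega>: "compact \<Omega>" "convex \<Omega>" "interior \<Omega> \<noteq> {}" and h: "0 < h" and v: "norm v = 1"
    and b: "\<forall>c\<ge>b. refl_line v c ` cap_plus \<Omega> v c \<subseteq> \<Omega>" and c: "b < c" "c < x \<bullet> v"
  shows "solid_angle \<Omega> h x < solid_angle \<Omega> h (refl_line v c x)"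
proof -
  let ?R = "refl_line v c" and ?I = "indicator \<Omega> :: _ \<Rightarrow> real" and ?K = "solid_kernel h"
  note int = integrable_solid_angle[OF \<Omega>(1) h]
  have RR: "?R (?R y) = y" for y by (rule refl_line_involution[OF v])
  have fold: "refl_line v d y \<in> \<Omega>" if "b \<le> d" "y \<in> \<Omega>" "d \<le> y \<bullet> v" for d y
    using b that unfolding cap_plus_def by blast
  have nR: "norm (?R y - ?R x) = norm (y - x)" for y x
  proof -
    have "(norm (?R y - ?R x))\<^sup>2 = (norm (?R y - x))\<^sup>2 + 4 * (?R y \<bullet> v - c) * (x \<bullet> v - c)"
      by (rule norm_refl_line_diff[OF v])
    also have "(norm (?R y - x))\<^sup>2 = (norm (x - y))\<^sup>2 + 4 * (x \<bullet> v - c) * (y \<bullet> v - c)"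
      using norm_refl_line_diff[OF v, of x c y] by (simp add: norm_minus_commute)
    finally show ?thesis
      by (simp add: refl_line_inner[OF v] norm_minus_commute algebra_simps)
  qed
  have K: "?K (?R y - z) = ?K (y - ?R z)" for y z
    using nR[of y "?R z"] by (simp add: RR solid_kernel_def)
  \<comment> \<open>Averaging the integrand of the difference with its reflection makes it pointwise nonnegative.\<close>
  define F where "F y = (?I y - ?I (?R y)) * (?K (y - ?R x) - ?K (y - x))" for y
  note int' = int[of x] int[of "?R x"] integrable_refl_line[OF v int, of c x]
    integrable_refl_line[OF v int, of c "?R x"]
  have F_eq: "F y = (?I y * ?K (y - ?R x) - ?I y * ?K (y - x)) +
      (?I (?R y) * ?K (?R y - ?R x) - ?I (?R y) * ?K (?R y - x))" for y
    by (simp add: F_def K RR algebra_simps)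
  have F: "integrable lborel F"
    unfolding F_eq using int' by (intro Bochner_Integration.integrable_add Bochner_Integration.integrable_diff)
  have "integral\<^sup>L lborel F = 2 * (solid_angle \<Omega> h (?R x) - solid_angle \<Omega> h x)"
    unfolding F_eq solid_angle_eq_lborel[OF \<Omega>(1) h] using int'
    by (simp add: integral_refl_line[OF v int, of c])
  moreover have "0 < integral\<^sup>L lborel F"
  proof (rule integral_pos_open[OF F])
    \<comment> \<open>These are interior points of \<open>\<Omega>\<close> that the reflection
      throws out of \<open>\<Omega>\<close>. By the folding condition they lie strictly below the
      line, so both factors of \<open>F\<close> are positive there.\<close>
    let ?U = "interior \<Omega> \<inter> {y. ?R y \<notin> \<Omega>}"
    have cR: "continuous_on UNIV ?R" unfolding refl_line_def by (intro continuous_intros)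
    \<comment> \<open>Here \<open>y\<close> is on the line or on the side opposite to
      \<open>x\<close>, so the correction term in \<open>norm_refl_line_diff\<close> is at most
      zero.\<close>
    have near: "?K (y - x) \<le> ?K (y - ?R x)" if "y \<bullet> v \<le> c" for y
    proof (rule solid_kernel_mono[OF h])
      have "4 * (y \<bullet> v - c) * (x \<bullet> v - c) \<le> 0" using that c by (simp add: mult_le_0_iff)
      then have "(norm (y - ?R x))\<^sup>2 \<le> (norm (y - x))\<^sup>2" unfolding norm_refl_line_diff[OF v] by linarith
      then show "norm (y - ?R x) \<le> norm (y - x)" by (rule power2_le_imp_le) simp
    qed
    show "0 \<le> F y" for y
    proof (cases "y \<bullet> v \<le> c")
      case True
      then have "y \<in> \<Omega>" if "?R y \<in> \<Omega>" using fold[of c "?R y"] that c by (simp add: RR refl_line_inner[OF v])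
      then show ?thesis using near[OF True] by (auto simp: F_def indicator_def)
    next
      case False
      then have "?R y \<in> \<Omega>" if "y \<in> \<Omega>" using fold[of c y] that c by simp
      moreover have "?K (y - ?R x) \<le> ?K (y - x)"
        using near[of "?R y"] False by (simp add: K RR refl_line_inner[OF v])
      ultimately show ?thesis by (auto simp: F_def indicator_def)
    qed
    have "{y. ?R y \<notin> \<Omega>} = ?R -` (- \<Omega>)" by auto
    then have op: "open {y. ?R y \<notin> \<Omega>}"
      using cR \<Omega>(1) by (simp add: open_vimage compact_imp_closed open_Compl)
    then show "open ?U" by auto
    have "\<Omega> \<noteq> {}" using \<Omega>(3) interior_subset by blast
    moreover have "continuous_on \<Omega> (\<lambda>y. y \<bullet> v)" by (intro continuous_intros)
    ultimately obtain m where m: "m \<in> \<Omega>" "\<And>y. y \<in> \<Omega> \<Longrightarrow> m \<bullet> v \<le> y \<bullet> v"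
      using continuous_attains_inf[OF \<Omega>(1)] by metis
    \<comment> \<open>Folding twice, first at \<open>c\<close> and then at \<open>b < c\<close>, would push \<open>m\<close> below the minimum.\<close>
    have mb: "m \<bullet> v \<le> b"
      using fold[of b m] m(2)[of "refl_line v b m"] m(1) by (force simp: refl_line_inner[OF v])
    have "?R m \<notin> \<Omega>"
      using fold[of b "?R m"] m(2)[of "refl_line v b (?R m)"] mb c by (force simp: refl_line_inner[OF v])
    \<comment> \<open>The point \<open>m\<close> lies on the boundary of \<open>\<Omega>\<close>. As
      a limit of interior points that belongs to the open set of points reflected out of
      \<open>\<Omega>\<close>, it still yields interior points in that set.\<close>
    moreover have "m \<in> closure (interior \<Omega>)"
      using m(1) convex_closure_interior[OF \<Omega>(2,3)] closure_subset by blast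
    ultimately show "?U \<noteq> {}" using open_Int_closure_eq_empty[OF op] by blast
    show "0 < F y" if "y \<in> ?U" for y
    proof -
      have y: "y \<in> \<Omega>" "?R y \<notin> \<Omega>" using that interior_subset by auto
      then have "y \<bullet> v < c" using fold[of c y] c by force
      then have "4 * (y \<bullet> v - c) * (x \<bullet> v - c) < 0" using c by (simp add: mult_less_0_iff)
      then have "(norm (y - ?R x))\<^sup>2 < (norm (y - x))\<^sup>2" unfolding norm_refl_line_diff[OF v] by linarith
      then have "norm (y - ?R x) < norm (y - x)" by (rule power2_less_imp_less) simp
      from solid_kernel_less[OF h this] y show ?thesis by (simp add: F_def)
    qed
  qed
  ultimately show ?thesis by simp
qed

lemma solid_angle_center_le_uf_upper:
  assumes \<Omega>: "compact \<Omega>" "convex \<Omega>" "interior \<Omega> \<noteq> {}" and h: "0 < h" and v: "norm v = 1"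
    and x: "solid_angle_center \<Omega> h x"
  shows "x \<bullet> v \<le> uf_upper \<Omega> v"
proof -
  define S where "S = {b. \<forall>c\<ge>b. refl_line v c ` cap_plus \<Omega> v c \<subseteq> \<Omega>}"
  obtain B where B: "\<And>y. y \<in> \<Omega> \<Longrightarrow> norm y \<le> B"
    using compact_imp_bounded[OF \<Omega>(1)] by (auto simp: bounded_iff)
  \<comment> \<open>Caps beyond the bounded set are empty and fold trivially. This makes
    \<open>S\<close> nonempty, without which its infimum would carry no information.\<close>
  have "cap_plus \<Omega> v c = {}" if "B + 1 \<le> c" for c
  proof -
    have "y \<bullet> v < c" if "y \<in> \<Omega>" for y
      using B[OF that] norm_cauchy_schwarz[of y v] v \<open>B + 1 \<le> c\<close> by simp
    then show ?thesis by (force simp: cap_plus_def)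
  qed
  then have "B + 1 \<in> S" by (simp add: S_def)
  then have ne: "S \<noteq> {}" by blast
  show ?thesis
  proof (rule ccontr)
    assume "\<not> ?thesis"
    then have "Inf S < x \<bullet> v" by (simp add: uf_upper_def S_def)
    then have "\<exists>b\<in>S. b < x \<bullet> v" by (rule cInf_lessD[OF ne])
    then obtain b where b: "b \<in> S" "b < x \<bullet> v" by blast
    then obtain c where "b < c" "c < x \<bullet> v" using dense by blast
    with b solid_angle_refl_line_less[OF \<Omega> h v, of b c x]
    have "solid_angle \<Omega> h x < solid_angle \<Omega> h (refl_line v c x)" by (simp add: S_def)
    with x show False unfolding solid_angle_center_def by (meson not_less)
  qed
qed

lemma uminus_image_iff: "(x :: real) \<in> uminus ` S \<longleftrightarrow> - x \<in> S"
  by (metis image_iff minus_minus)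

text \<open>Reversing \<open>v\<close> exchanges the two kinds of caps and negates the levels, so
  lower bounds for centers follow from the upper bounds. On the reals \<open>Inf\<close> is by
  definition the negated \<open>Sup\<close> of the negated set, which reduces the claim to an
  identity of sets.\<close>

lemma uf_lower_eq: "uf_lower \<Omega> v = - uf_upper \<Omega> (- v)"
proof -
  have r: "refl_line v (- c) = refl_line (- v) c" for c
    by (auto simp: refl_line_def fun_eq_iff algebra_simps)
  have p: "cap_minus \<Omega> v (- c) = cap_plus \<Omega> (- v) c" for c
    by (auto simp: cap_minus_def cap_plus_def)
  let ?A = "{b. \<forall>c\<le>b. refl_line v c ` cap_minus \<Omega> v c \<subseteq> \<Omega>}"
  let ?B = "{b. \<forall>c\<ge>b. refl_line (-v) c ` cap_plus \<Omega> (-v) c \<subseteq> \<Omega>}"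
  have BA: "b \<in> ?B \<longleftrightarrow> - b \<in> ?A" for b
  proof -
    have "(\<forall>c\<ge>b. refl_line (-v) c ` cap_plus \<Omega> (-v) c \<subseteq> \<Omega>) \<longleftrightarrow>
        (\<forall>c\<ge>b. refl_line v (-c) ` cap_minus \<Omega> v (-c) \<subseteq> \<Omega>)"
      by (simp only: r p)
    also have "\<dots> \<longleftrightarrow> (\<forall>c\<le>-b. refl_line v c ` cap_minus \<Omega> v c \<subseteq> \<Omega>)"
      by (rule iffI; intro allI impI; drule_tac x="- c" in spec) auto
    finally show ?thesis by simp
  qed
  have AB: "a \<in> ?A \<longleftrightarrow> - a \<in> ?B" for a using BA[of "- a"] by (simp only: minus_minus)
  have "?A = uminus ` ?B"
    by (intro set_eqI) (simp only: uminus_image_iff AB)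
  then show ?thesis unfolding uf_lower_def uf_upper_def Inf_real_def by (simp only: minus_minus)
qed

lemma solid_angle_center_in_min_unfolded:
  assumes "compact \<Omega>" "convex \<Omega>" "interior \<Omega> \<noteq> {}" "0 < h" "solid_angle_center \<Omega> h x"
  shows "x \<in> min_unfolded \<Omega>"
proof -
  have "uf_lower \<Omega> v \<le> x \<bullet> v \<and> x \<bullet> v \<le> uf_upper \<Omega> v" if "norm v = 1" for v
    using solid_angle_center_le_uf_upper[OF assms(1-4) that assms(5)]
      solid_angle_center_le_uf_upper[OF assms(1-4) _ assms(5), of "- v"] that
    by (simp add: uf_lower_eq)
  then show ?thesis by (simp add: min_unfolded_def)
qed

subsection \<open>The solid angle in polar coordinates\<close>

text \<open>The primitive of \<open>r * h / (r\<^sup>2 + h\<^sup>2) powr (3/2)\<close> that vanishes at \<open>0\<close>.\<close>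
definition visible_angle :: "real \<Rightarrow> real \<Rightarrow> real" where
  "visible_angle h r = 1 - h * (r\<^sup>2 + h\<^sup>2) powr (-1/2)"

lemma DERIV_visible_angle:
  assumes "0 < h"
  shows "(visible_angle h has_real_derivative r * (h / (r\<^sup>2 + h\<^sup>2) powr (3/2))) (at r)"
proof -
  have "0 < r\<^sup>2 + h\<^sup>2" using assms by (simp add: add_nonneg_pos)
  then have "(visible_angle h has_real_derivative r * (h * (r\<^sup>2 + h\<^sup>2) powr (-1/2 - 1))) (at r)"
    unfolding visible_angle_def by (auto intro!: derivative_eq_intros)
  then show ?thesis by (simp add: powr_minus_divide)
qed

text \<open>The constant \<open>sqrt 2\<close> originates here: the derivative of \<open>?q\<close>
  has the sign of \<open>h\<^sup>2 - 2 * r\<^sup>2\<close>, which is negative as soon as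
  \<open>r\<close> exceeds \<open>h / sqrt 2\<close>.\<close>

lemma visible_angle_deriv_less:
  assumes h: "0 < h" and s: "h \<le> sqrt 2 * s" and st: "s < t"
  shows "t * (h / (t\<^sup>2 + h\<^sup>2) powr (3/2)) < s * (h / (s\<^sup>2 + h\<^sup>2) powr (3/2))"
proof -
  let ?q = "\<lambda>r. r * (h * (r\<^sup>2 + h\<^sup>2) powr (-3/2))"
  have pos: "0 < r\<^sup>2 + h\<^sup>2" for r using h by (simp add: add_nonneg_pos)
  have D: "(?q has_real_derivative h * (r\<^sup>2 + h\<^sup>2) powr (-5/2) * (h\<^sup>2 - 2 * r\<^sup>2)) (at r)" for r
  proof -
    \<comment> \<open>Splitting the exponent exposes the common power -5/2 of the two terms produced
      by the product rule.\<close>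
    have "(r\<^sup>2 + h\<^sup>2) powr (-3/2) = (r\<^sup>2 + h\<^sup>2) powr (-5/2 + 1)" by simp
    also have "\<dots> = (r\<^sup>2 + h\<^sup>2) powr (-5/2) * (r\<^sup>2 + h\<^sup>2)"
      using pos[of r] by (subst powr_add) simp
    finally have e: "(r\<^sup>2 + h\<^sup>2) powr (-3/2) = (r\<^sup>2 + h\<^sup>2) powr (-5/2) * (r\<^sup>2 + h\<^sup>2)" .
    have "(?q has_real_derivative h * (r\<^sup>2 + h\<^sup>2) powr (-3/2) +
        r * (h * ((-3/2) * (r\<^sup>2 + h\<^sup>2) powr (-5/2) * (2 * r)))) (at r)"
      using pos[of r] by (auto intro!: derivative_eq_intros)
    then show ?thesis unfolding e by (simp add: algebra_simps power2_eq_square)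
  qed
  have "?q t < ?q s"
  proof (rule DERIV_neg_imp_decreasing_open[OF st])
    show "continuous_on {s..t} ?q"
      using pos by (intro continuous_intros) (auto simp: less_le)
    fix r assume "s < r" "r < t"
    then have "h < sqrt 2 * r" using s by (meson le_less_trans mult_strict_left_mono real_sqrt_gt_zero zero_less_numeral)
    then have "h\<^sup>2 < (sqrt 2 * r)\<^sup>2" using h by (simp add: power_strict_mono)
    then have "h\<^sup>2 - 2 * r\<^sup>2 < 0" by (simp add: power_mult_distrib)
    then have "h * (r\<^sup>2 + h\<^sup>2) powr (-5/2) * (h\<^sup>2 - 2 * r\<^sup>2) < 0"
      using h pos[of r] by (intro mult_pos_neg) auto
    with D show "\<exists>y. (?q has_real_derivative y) (at r) \<and> y < 0" by blast
  qed
  then show ?thesis by (simp add: powr_minus_divide)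
qed

lemma visible_angle_mono:
  assumes "0 < h" "0 \<le> r" "r \<le> s" shows "visible_angle h r \<le> visible_angle h s"
proof (rule DERIV_nonneg_imp_nondecreasing[OF assms(3)])
  fix x assume "r \<le> x" "x \<le> s"
  then have "0 \<le> x * (h / (x\<^sup>2 + h\<^sup>2) powr (3/2))" using assms by simp
  with DERIV_visible_angle[OF assms(1)]
  show "\<exists>y. (visible_angle h has_real_derivative y) (at x) \<and> 0 \<le> y" by blast
qed

text \<open>The mean value theorem on the two halves of the interval compares slopes at points
  \<open>y < z\<close>, and beyond \<open>h / sqrt 2\<close> the slope strictly decreases.\<close>

lemma visible_angle_midpoint_less:
  assumes h: "0 < h" and a: "h \<le> sqrt 2 * a" and ab: "a < b"
  shows "visible_angle h a + visible_angle h b < 2 * visible_angle h ((a + b) / 2)"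
proof -
  let ?m = "(a + b) / 2" and ?q = "\<lambda>r. r * (h / (r\<^sup>2 + h\<^sup>2) powr (3/2))"
  have m: "a < ?m" "?m < b" using ab by auto
  obtain y where y: "a < y" "y < ?m" "visible_angle h ?m - visible_angle h a = (?m - a) * ?q y"
    using MVT2[OF m(1), of "visible_angle h" ?q] DERIV_visible_angle[OF h] by blast
  obtain z where z: "?m < z" "z < b" "visible_angle h b - visible_angle h ?m = (b - ?m) * ?q z"
    using MVT2[OF m(2), of "visible_angle h" ?q] DERIV_visible_angle[OF h] by blast
  have "h \<le> sqrt 2 * y" using a y(1) by (smt (verit) mult_left_mono real_sqrt_ge_zero)
  then have "?q z < ?q y" by (rule visible_angle_deriv_less[OF h]) (use y z in auto)
  then have "(?m - a) * ?q z < (?m - a) * ?q y" using m by (intro mult_strict_left_mono) auto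
  moreover have e: "b - ?m = ?m - a" by (simp add: field_simps)
  ultimately show ?thesis using y(3) z(3)[unfolded e] by linarith
qed

section \<open>Radial extents and strict midpoint concavity of the solid angle\<close>

definition radial_extent :: "'a::real_normed_vector set \<Rightarrow> 'a \<Rightarrow> 'a \<Rightarrow> real" where
  "radial_extent \<Omega> x u = (THE \<rho>. 0 \<le> \<rho> \<and> (\<forall>r\<ge>0. x + r *\<^sub>R u \<in> \<Omega> \<longleftrightarrow> r \<le> \<rho>))"

text \<open>The ray first meets the frontier at some parameter \<open>d\<close>, and convexity
  forbids a return afterwards, so the description in \<open>radial_extent\<close> has a unique
  solution. The direction \<open>u\<close> may have any nonzero length; extents count multiples of
  \<open>u\<close>.\<close>

lemma
  fixes \<Omega> :: "'a::euclidean_space set"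
  assumes \<Omega>: "compact \<Omega>" "convex \<Omega>" and x: "x \<in> interior \<Omega>" and u: "u \<noteq> 0"
  shows radial_extent_pos: "0 < radial_extent \<Omega> x u"
    and radial_extent_iff: "0 \<le> r \<Longrightarrow> x + r *\<^sub>R u \<in> \<Omega> \<longleftrightarrow> r \<le> radial_extent \<Omega> x u"
    and radial_extent_frontier: "x + radial_extent \<Omega> x u *\<^sub>R u \<in> frontier \<Omega>"
    and radial_extent_interior: "0 \<le> r \<Longrightarrow> r < radial_extent \<Omega> x u \<Longrightarrow> x + r *\<^sub>R u \<in> interior \<Omega>"
proof -
  obtain d where d: "0 < d" "x + d *\<^sub>R u \<in> frontier \<Omega>"
    "\<And>e. 0 \<le> e \<Longrightarrow> e < d \<Longrightarrow> x + e *\<^sub>R u \<in> interior \<Omega>"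
    using ray_to_frontier[OF compact_imp_bounded[OF \<Omega>(1)] x u] by blast
  have iff: "x + r *\<^sub>R u \<in> \<Omega> \<longleftrightarrow> r \<le> d" if "0 \<le> r" for r
  proof
    assume r: "x + r *\<^sub>R u \<in> \<Omega>"
    show "r \<le> d"
    proof (rule ccontr)
      assume "\<not> r \<le> d"
      \<comment> \<open>The factor \<open>1 - d / r\<close> shrinks the later point towards
        \<open>x\<close> exactly onto the exit point, which would then be interior although it lies
        on the frontier.\<close>
      then have "(x + r *\<^sub>R u) - (1 - d / r) *\<^sub>R ((x + r *\<^sub>R u) - x) \<in> interior \<Omega>"
        using d(1) by (intro mem_interior_convex_shrink[OF \<Omega>(2) x r]) auto
      also have "(x + r *\<^sub>R u) - (1 - d / r) *\<^sub>R ((x + r *\<^sub>R u) - x) = x + d *\<^sub>R u"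
        using \<open>\<not> r \<le> d\<close> d(1) by (simp add: algebra_simps)
      finally show False using d(2) by (simp add: frontier_def)
    qed
  next
    assume "r \<le> d"
    have "frontier \<Omega> \<subseteq> \<Omega>" using \<Omega>(1) by (simp add: compact_imp_closed frontier_subset_closed)
    with \<open>r \<le> d\<close> that d(2) d(3)[of r] show "x + r *\<^sub>R u \<in> \<Omega>"
      using interior_subset by (cases "r = d") auto
  qed
  have "radial_extent \<Omega> x u = d"
    unfolding radial_extent_def
  proof (rule the_equality)
    show "0 \<le> d \<and> (\<forall>r\<ge>0. (x + r *\<^sub>R u \<in> \<Omega>) = (r \<le> d))" using iff d(1) by auto
    show "\<rho> = d" if "0 \<le> \<rho> \<and> (\<forall>r\<ge>0. (x + r *\<^sub>R u \<in> \<Omega>) = (r \<le> \<rho>))" for \<rho>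
      using that iff[of d] iff[of \<rho>] d(1) by (meson less_eq_real_def order_antisym)
  qed
  with d iff show "0 < radial_extent \<Omega> x u"
    "0 \<le> r \<Longrightarrow> x + r *\<^sub>R u \<in> \<Omega> \<longleftrightarrow> r \<le> radial_extent \<Omega> x u"
    "x + radial_extent \<Omega> x u *\<^sub>R u \<in> frontier \<Omega>"
    "0 \<le> r \<Longrightarrow> r < radial_extent \<Omega> x u \<Longrightarrow> x + r *\<^sub>R u \<in> interior \<Omega>" by auto
qed

text \<open>After recentering at \<open>x\<close>, the inner polar integral runs over the radii up
  to the radial extent, and \<open>visible_angle h\<close> is an antiderivative of its
  integrand.\<close>

lemma
  assumes \<Omega>: "compact \<Omega>" "convex \<Omega>" and h: "0 < h" and x: "x \<in> interior \<Omega>"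
  shows integrable_solid_angle_polar:
      "integrable lborel (\<lambda>t. indicator {-pi<..pi} t * visible_angle h (radial_extent \<Omega> x (polar 1 t)))"
    and solid_angle_polar:
      "solid_angle \<Omega> h x =
        (\<integral>t. indicator {-pi<..pi} t * visible_angle h (radial_extent \<Omega> x (polar 1 t)) \<partial>lborel)"
proof -
  define f where "f y = indicator \<Omega> (x + y) * solid_kernel h y" for y
  have shift: "(+) x \<in> measurable lborel borel" by simp
  have [measurable]: "\<Omega> \<in> sets borel" using \<Omega>(1) by (simp add: borel_compact)
  have m: "(\<lambda>y. indicator \<Omega> y * solid_kernel h (y - x)) \<in> borel_measurable borel" by measurable
  have f: "integrable lborel f"
    using integrable_solid_angle[OF \<Omega>(1) h, of x] integrable_distr_eq[OF shift m]
    unfolding lborel_distr_plus f_def by simp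
  have "integral\<^sup>L lborel f = solid_angle \<Omega> h x"
    using integral_distr[OF shift m]
    unfolding lborel_distr_plus f_def solid_angle_eq_lborel[OF \<Omega>(1) h] by simp
  moreover have "(\<integral>r. indicator {0<..} r * (r * f (polar r t)) \<partial>lborel) = visible_angle h (radial_extent \<Omega> x (polar 1 t))"
    (is "?l = visible_angle h ?\<rho>") for t
  proof -
    have u: "polar 1 t \<noteq> 0" using norm_polar[of 1 t] by force
    let ?q = "\<lambda>r. r * (h / (r\<^sup>2 + h\<^sup>2) powr (3/2))"
    \<comment> \<open>Including the endpoint 0 is harmless, since the factor \<open>r\<close>
      vanishes there.\<close>
    have "indicator {0<..} r * (r * f (polar r t)) = ?q r * indicator {0..?\<rho>} r" for r
      using radial_extent_iff[OF \<Omega> x u, of r]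
      by (cases "0 < r") (auto simp: f_def solid_kernel_def indicator_def polar_scaleR[of r t, symmetric])
    then have "?l = (\<integral>r. ?q r * indicator {0..?\<rho>} r \<partial>lborel)" by simp
    also have "\<dots> = visible_angle h ?\<rho> - visible_angle h 0"
    proof (rule integral_FTC_Icc_real)
      show "0 \<le> ?\<rho>" using radial_extent_pos[OF \<Omega> x u] by simp
      show "DERIV (visible_angle h) r :> ?q r" for r by (rule DERIV_visible_angle[OF h])
      show "isCont ?q r" for r
        using h by (intro continuous_intros) (auto simp: add_nonneg_eq_0_iff)
    qed
    also have "visible_angle h 0 = 0"
      using h by (simp add: visible_angle_def powr_minus_divide powr_half_sqrt)
    finally show ?thesis by simp
  qed
  ultimately show "integrable lborel (\<lambda>t. indicator {-pi<..pi} t * visible_angle h (radial_extent \<Omega> x (polar 1 t)))"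
    "solid_angle \<Omega> h x =
        (\<integral>t. indicator {-pi<..pi} t * visible_angle h (radial_extent \<Omega> x (polar 1 t)) \<partial>lborel)"
    using integrable_polar[OF f] integral_polar[OF f] by simp_all
qed

text \<open>The midpoint of the two exit points belongs to \<open>\<Omega>\<close> by convexity and
  lies on the parallel ray from the midpoint of \<open>x\<close> and \<open>y\<close>, at the
  averaged parameter.\<close>

lemma radial_extent_midpoint:
  fixes \<Omega> :: "'a::euclidean_space set"
  assumes \<Omega>: "compact \<Omega>" "convex \<Omega>" and x: "x \<in> interior \<Omega>" "y \<in> interior \<Omega>" and u: "u \<noteq> 0"
  shows "(radial_extent \<Omega> x u + radial_extent \<Omega> y u) / 2 \<le> radial_extent \<Omega> (midpoint x y) u"
proof -
  let ?a = "radial_extent \<Omega> x u" and ?b = "radial_extent \<Omega> y u"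
  have pos: "0 < ?a" "0 < ?b" using radial_extent_pos[OF \<Omega> _ u] x by auto
  have m: "midpoint x y \<in> interior \<Omega>"
    using convexD_alt[OF convex_interior[OF \<Omega>(2)] x, of "1/2"] by (simp add: midpoint_def algebra_simps)
  have "x + ?a *\<^sub>R u \<in> \<Omega>" "y + ?b *\<^sub>R u \<in> \<Omega>"
    using radial_extent_iff[OF \<Omega> _ u] x pos by (auto simp: less_imp_le)
  then have "(1 - 1/2) *\<^sub>R (x + ?a *\<^sub>R u) + (1/2) *\<^sub>R (y + ?b *\<^sub>R u) \<in> \<Omega>"
    by (intro convexD_alt[OF \<Omega>(2)]) auto
  also have "(1 - 1/2) *\<^sub>R (x + ?a *\<^sub>R u) + (1/2) *\<^sub>R (y + ?b *\<^sub>R u) = midpoint x y + ((?a + ?b) / 2) *\<^sub>R u"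
    by (simp add: midpoint_def algebra_simps add_divide_distrib)
  finally show ?thesis using radial_extent_iff[OF \<Omega> m u, of "(?a + ?b) / 2"] pos by simp
qed

text \<open>With step \<open>y - x\<close>, the point \<open>y\<close> is one unit along the ray
  from \<open>x\<close>, so the extent from \<open>x\<close> exceeds the one from \<open>y\<close>
  by at least 1. This supplies a direction in which the two extents differ.\<close>

lemma radial_extent_translate_less:
  fixes \<Omega> :: "'a::euclidean_space set"
  assumes \<Omega>: "compact \<Omega>" "convex \<Omega>" and x: "x \<in> interior \<Omega>" "y \<in> interior \<Omega>" and ne: "x \<noteq> y"
  shows "radial_extent \<Omega> y (y - x) < radial_extent \<Omega> x (y - x)"
proof -
  let ?u = "y - x" and ?b = "radial_extent \<Omega> y (y - x)"
  have u: "?u \<noteq> 0" using ne by simp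
  have b: "0 < ?b" by (rule radial_extent_pos[OF \<Omega> x(2) u])
  then have "y + ?b *\<^sub>R ?u \<in> \<Omega>" using radial_extent_iff[OF \<Omega> x(2) u, of ?b] by simp
  also have "y + ?b *\<^sub>R ?u = x + (1 + ?b) *\<^sub>R ?u" by (simp add: algebra_simps)
  finally show ?thesis using radial_extent_iff[OF \<Omega> x(1) u, of "1 + ?b"] b by simp
qed

text \<open>The inequality holds direction by direction and is strict wherever the extents from
  \<open>x\<close> and \<open>y\<close> differ. To make it strict after integration, such directions
  must fill a nonempty open set, which is found around the direction \<open>t0\<close> from
  \<open>x\<close> to \<open>y\<close>.\<close>

lemma solid_angle_midpoint_greater:
  assumes \<Omega>: "compact \<Omega>" "convex \<Omega>" and h: "0 < h" and xy: "x \<in> interior \<Omega>" "y \<in> interior \<Omega>" "x \<noteq> y"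
    and hx: "\<And>w. w \<in> frontier \<Omega> \<Longrightarrow> h \<le> sqrt 2 * dist x w"
    and hy: "\<And>w. w \<in> frontier \<Omega> \<Longrightarrow> h \<le> sqrt 2 * dist y w"
  shows "solid_angle \<Omega> h x + solid_angle \<Omega> h y < 2 * solid_angle \<Omega> h (midpoint x y)"
proof -
  let ?m = "midpoint x y"
  define \<rho> where "\<rho> z t = radial_extent \<Omega> z (polar 1 t)" for z t
  define W where "W z t = indicator {-pi<..pi} t * visible_angle h (\<rho> z t)" for z t
  have u: "polar 1 t \<noteq> 0" for t using norm_polar[of 1 t] by force
  have m: "?m \<in> interior \<Omega>"
    using convexD_alt[OF convex_interior[OF \<Omega>(2)] xy(1,2), of "1/2"] by (simp add: midpoint_def algebra_simps)
  have int: "integrable lborel (W z)" and eq: "solid_angle \<Omega> h z = integral\<^sup>L lborel (W z)"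
    if "z \<in> interior \<Omega>" for z
    using integrable_solid_angle_polar[OF \<Omega> h that] solid_angle_polar[OF \<Omega> h that]
    unfolding W_def \<rho>_def by auto
  \<comment> \<open>The exit point lies on the frontier at distance \<open>\<rho> z t\<close> from
    \<open>z\<close>, so the assumed distance bound becomes a bound on every radius.\<close>
  have far: "h \<le> sqrt 2 * \<rho> z t" if "z \<in> interior \<Omega>" "\<And>w. w \<in> frontier \<Omega> \<Longrightarrow> h \<le> sqrt 2 * dist z w" for z t
    using that(2)[OF radial_extent_frontier[OF \<Omega> that(1) u, of t]] radial_extent_pos[OF \<Omega> that(1) u, of t]
    by (simp add: \<rho>_def dist_norm)
  have pos: "0 < \<rho> z t" if "z \<in> interior \<Omega>" for z t
    unfolding \<rho>_def by (rule radial_extent_pos[OF \<Omega> that u])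
  have mid: "visible_angle h ((\<rho> x t + \<rho> y t) / 2) \<le> visible_angle h (\<rho> ?m t)" for t
    using radial_extent_midpoint[OF \<Omega> xy(1,2) u, of t] pos[OF xy(1), of t] pos[OF xy(2), of t]
    unfolding \<rho>_def by (intro visible_angle_mono[OF h]) auto
  have less: "visible_angle h (\<rho> x t) + visible_angle h (\<rho> y t) < 2 * visible_angle h (\<rho> ?m t)"
    if "\<rho> x t \<noteq> \<rho> y t" for t
  proof (cases "\<rho> x t < \<rho> y t")
    case True
    then show ?thesis
      using visible_angle_midpoint_less[OF h far[OF xy(1) hx] True] mid[of t] by linarith
  next
    case False
    then have "\<rho> y t < \<rho> x t" using that by simp
    then show ?thesis
      using visible_angle_midpoint_less[OF h far[OF xy(2) hy], of t "\<rho> x t"] mid[of t] by (simp add: add.commute)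
  qed
  have le: "visible_angle h (\<rho> x t) + visible_angle h (\<rho> y t) \<le> 2 * visible_angle h (\<rho> ?m t)" for t
    using less[of t] mid[of t] by (cases "\<rho> x t = \<rho> y t") auto
  obtain t0 where t0: "-pi < t0" "t0 \<le> pi" "y - x = polar (norm (y - x)) t0"
    using polar_exists[of "y - x"] xy(3) by auto
  have yx: "y - x = norm (y - x) *\<^sub>R polar 1 t0" using t0(3) polar_scaleR by metis
  \<comment> \<open>\<open>s0\<close> separates the two extents measured in multiples of
    \<open>y - x\<close>; \<open>s\<close> below is the same threshold measured along the unit
    vector.\<close>
  obtain s0 where s0: "radial_extent \<Omega> y (y - x) < s0" "s0 < radial_extent \<Omega> x (y - x)"
    using radial_extent_translate_less[OF \<Omega> xy] dense by blast
  have nz: "y - x \<noteq> 0" using xy(3) by simp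
  have s0pos: "0 < s0" using s0(1) radial_extent_pos[OF \<Omega> xy(2) nz] by linarith
  define s where "s = s0 * norm (y - x)"
  have s: "0 < s" "s0 *\<^sub>R (y - x) = s *\<^sub>R polar 1 t0"
    using s0pos nz yx by (auto simp: s_def) (metis scaleR_scaleR)
  \<comment> \<open>At radius \<open>s\<close> the ray from \<open>x\<close> is still inside
    \<open>\<Omega>\<close> and the ray from \<open>y\<close> has already left it. Both conditions
    are open in the angle and force different extents.\<close>
  define V where "V = {t. x + s *\<^sub>R polar 1 t \<in> interior \<Omega>} \<inter> {t. y + s *\<^sub>R polar 1 t \<notin> \<Omega>}"
  have cont: "continuous_on UNIV (\<lambda>t. z + s *\<^sub>R polar 1 t)" for z
    by (intro continuous_intros continuous_polar)
  have "V = (\<lambda>t. x + s *\<^sub>R polar 1 t) -` interior \<Omega> \<inter> (\<lambda>t. y + s *\<^sub>R polar 1 t) -` (- \<Omega>)"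
    by (auto simp: V_def)
  then have "open V"
    using cont \<Omega>(1) by (simp add: open_Int open_vimage compact_imp_closed open_Compl)
  have "t0 \<in> V"
    using radial_extent_interior[OF \<Omega> xy(1) nz, of s0] radial_extent_iff[OF \<Omega> xy(2) nz, of s0] s0 s0pos
    by (simp add: V_def flip: s(2))
  \<comment> \<open>The angle \<open>t0\<close> may equal \<open>pi\<close>, an endpoint of the
    range, so it is only a limit of angles in the open interval; openness of \<open>V\<close> makes
    this sufficient.\<close>
  moreover have "t0 \<in> closure {-pi<..<pi}" using t0 by simp
  ultimately have V: "V \<inter> {-pi<..<pi} \<noteq> {}" using open_Int_closure_eq_empty[OF \<open>open V\<close>] by blast
  have Vne: "\<rho> x t \<noteq> \<rho> y t" if "t \<in> V" for t
  proof -
    have "s \<le> \<rho> x t" "\<not> s \<le> \<rho> y t"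
      using that radial_extent_iff[OF \<Omega> xy(1) u, of s t] radial_extent_iff[OF \<Omega> xy(2) u, of s t] s(1) interior_subset[of \<Omega>]
      by (auto simp: V_def \<rho>_def)
    then show ?thesis by linarith
  qed
  define F where "F t = 2 * W ?m t - W x t - W y t" for t
  have F: "integrable lborel F"
    unfolding F_def using int m xy by auto
  have "0 < integral\<^sup>L lborel F"
  proof (rule integral_pos_open[OF F])
    show "0 \<le> F t" for t using le[of t] by (auto simp: F_def W_def indicator_def)
    show "open (V \<inter> {-pi<..<pi})" using \<open>open V\<close> by auto
    show "0 < F t" if "t \<in> V \<inter> {-pi<..<pi}" for t
      using that less[OF Vne, of t] by (auto simp: F_def W_def indicator_def)
  qed (rule V)
  moreover have "integral\<^sup>L lborel F = 2 * solid_angle \<Omega> h ?m - solid_angle \<Omega> h x - solid_angle \<Omega> h y"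
    unfolding F_def using int m xy by (simp add: eq)
  ultimately show ?thesis by simp
qed

theorem theorem4p9:
  fixes \<Omega> :: "(real^2) set" and h :: real
  assumes "compact \<Omega>" and "convex \<Omega>" and "interior \<Omega> \<noteq> {}"
    and "min_unfolded \<Omega> \<subseteq> interior \<Omega>"
    and "0 < h"
    and "h \<le> sqrt 2 * Inf {dist z w | z w. z \<in> min_unfolded \<Omega> \<and> w \<in> frontier \<Omega>}"
  shows "\<exists>!x. solid_angle_center \<Omega> h x"
proof (rule ex_ex1I)
  show "\<exists>x. solid_angle_center \<Omega> h x"
    using solid_angle_center_exists[of \<Omega> h] assms interior_subset by blast
  fix x y assume xy: "solid_angle_center \<Omega> h x" "solid_angle_center \<Omega> h y"
  show "x = y"
  proof (rule ccontr)
    assume "x \<noteq> y"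
    have uf: "z \<in> min_unfolded \<Omega>" if "solid_angle_center \<Omega> h z" for z
      by (rule solid_angle_center_in_min_unfolded[OF assms(1-3,5) that])
    \<comment> \<open>Centers lie in the minimal unfolded region, so their distances to the frontier
      are among those over which the infimum is taken; that set is bounded below by 0.\<close>
    have far: "h \<le> sqrt 2 * dist z w" if "solid_angle_center \<Omega> h z" "w \<in> frontier \<Omega>" for z w
    proof -
      let ?D = "{dist z w | z w. z \<in> min_unfolded \<Omega> \<and> w \<in> frontier \<Omega>}"
      have "bdd_below ?D" by (rule bdd_belowI[of _ 0]) auto
      then have "Inf ?D \<le> dist z w" using uf that by (intro cInf_lower) auto
      then have "sqrt 2 * Inf ?D \<le> sqrt 2 * dist z w" by (intro mult_left_mono) auto
      with assms(6) show ?thesis by linarith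
    qed
    have "solid_angle \<Omega> h x + solid_angle \<Omega> h y < 2 * solid_angle \<Omega> h (midpoint x y)"
      by (rule solid_angle_midpoint_greater[OF assms(1,2,5)]) (use xy uf far assms(4) \<open>x \<noteq> y\<close> in auto)
    moreover have "solid_angle \<Omega> h (midpoint x y) \<le> solid_angle \<Omega> h x"
      "solid_angle \<Omega> h (midpoint x y) \<le> solid_angle \<Omega> h y"
      using xy by (auto simp: solid_angle_center_def)
    ultimately show False by linarith
  qed
qed

end
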